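(* For every fixed real $n>1$, the function $\tau\mapsto \operatorname{li}(n;\tau)$ (the septic parametric logarithmic operator) is globally of class $C^3$ in the parameter $\tau$ on the entire domain $\mathbb{R}^+$.
   Context: Septic parametric logarithmic operator: for real $n>1$ and a real truncation parameter $\tau\in\mathbb{R}^+$, put $k=\lfloor\tau\rfloor\in\mathbb{N}_0$ and define $$\operatorname{li}(n;\tau)=\frac{n}{\ln n}\left(\sum_{j=0}^{k-1}\frac{j!}{\ln^j n}+\phi(\tau-\lfloor\tau\rfloor)\frac{k!}{\ln^k n}\right),\qquad \phi(x)=35x^4-84x^5+70x^6-20x^7 .$$ The empty sum is $0$, so $\operatorname{li}(n;\tau)=\frac{n}{\ln n}\phi(\tau)$ for $\tau\in[0,1]$. Here $\ln^j n=(\ln n)^j$. *)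

theory Defs
  imports Complex_Main
begin

text \<open>
  Functions of class \<open>C\<^sup>m\<close> on a set \<open>S\<close> of reals: \<open>D i\<close> is the \<open>i\<close>-th derivative. Derivatives
  are taken within \<open>S\<close>, i.e. they are ordinary two-sided derivatives at interior points and
  one-sided derivatives at an end point of an interval \<open>S\<close>.
\<close>

definition Ck_on :: "nat \<Rightarrow> (real \<Rightarrow> real) \<Rightarrow> real set \<Rightarrow> bool" where
  "Ck_on m f S \<longleftrightarrow>
     (\<exists>D :: nat \<Rightarrow> real \<Rightarrow> real.
        (\<forall>x\<in>S. D 0 x = f x) \<and>
        (\<forall>i<m. \<forall>x\<in>S. (D i has_real_derivative D (Suc i) x) (at x within S)) \<and>
        continuous_on S (D m))"

lemma Ck_on_subset:
  assumes "Ck_on m f S" "T \<subseteq> S"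
  shows "Ck_on m f T"
proof -
  from assms(1) obtain D where D: "\<forall>x\<in>S. D 0 x = f x"
    "\<forall>i<m. \<forall>x\<in>S. (D i has_real_derivative D (Suc i) x) (at x within S)"
    "continuous_on S (D m)"
    unfolding Ck_on_def by blast
  have "(D i has_real_derivative D (Suc i) x) (at x within T)" if "i < m" "x \<in> T" for i x
    using D(2) that assms(2) DERIV_subset by blast
  moreover have "continuous_on T (D m)"
    using D(3) assms(2) continuous_on_subset by blast
  ultimately show ?thesis
    unfolding Ck_on_def using D(1) assms(2) by (intro exI[of _ D]) auto
qed

definition septic :: "real \<Rightarrow> real" where
  "septic x = 35 * x ^ 4 - 84 * x ^ 5 + 70 * x ^ 6 - 20 * x ^ 7"

text \<open>
  Only \<open>n > 1\<close> and \<open>\<tau> \<ge> 0\<close> are meaningful; there \<open>nat \<lfloor>\<tau>\<rfloor>\<close> is the truncation index \<open>k\<close>.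
\<close>

definition li :: "real \<Rightarrow> real \<Rightarrow> real" where
  "li n \<tau> =
     (let k = nat \<lfloor>\<tau>\<rfloor> in
        n / ln n * ((\<Sum>j<k. fact j / ln n ^ j)
                    + septic (\<tau> - of_int \<lfloor>\<tau>\<rfloor>) * (fact k / ln n ^ k)))"

end

theory Submission
  imports Defs
begin

text \<open>
  Let \<open>S\<close> be the septic polynomial stopped at the ends of \<open>[0, 1]\<close>, i.e. \<open>0\<close> on the left and \<open>1\<close> on
  the right. The derivative of the polynomial is \<open>140 x\<^sup>3 (1 - x)\<^sup>3\<close>, so its derivatives of orders
  one to three vanish at \<open>0\<close> and \<open>1\<close>, and \<open>S\<close> is \<open>C\<^sup>3\<close> on the line. For \<open>\<tau> \<ge> 0\<close>, the operator is the
  locally finite sum of the terms \<open>n / ln n * j! / ln\<^sup>j n * S (\<tau> - j)\<close>.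
\<close>

lemma DERIV_split:
  fixes f :: "real \<Rightarrow> real"
  assumes "(f has_real_derivative D) (at x within {..x})"
    "(f has_real_derivative D) (at x within {x..})"
  shows "(f has_real_derivative D) (at x)"
proof -
  have "(f has_real_derivative D) (at_left x)" "(f has_real_derivative D) (at_right x)"
    using assms by (auto elim: DERIV_subset)
  then show ?thesis
    unfolding has_field_derivative_iff by (rule filterlim_split_at)
qed

text \<open>The stopped function is constant left of \<open>a\<close> and equals \<open>f\<close>
  right of it. At \<open>a\<close> itself the two one-sided derivatives are \<open>0\<close> and
  \<open>f' a\<close>, which agree by assumption.\<close>

lemma DERIV_comp_max:
  fixes f f' :: "real \<Rightarrow> real"
  assumes f: "\<And>x. (f has_real_derivative f' x) (at x)" and "f' a = 0"
  shows "((\<lambda>x. f (max a x)) has_real_derivative f' (max a x)) (at x)"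
proof (rule DERIV_split)
  show "((\<lambda>x. f (max a x)) has_real_derivative f' (max a x)) (at x within {..x})"
  proof (cases "x \<le> a")
    case True
    have "((\<lambda>_. f a) has_real_derivative 0) (at x within {..x})" by simp
    then have "((\<lambda>x. f (max a x)) has_real_derivative 0) (at x within {..x})"
      by (rule has_field_derivative_transform_within[OF _ zero_less_one])
        (use True in \<open>auto simp: max_absorb1\<close>)
    with True \<open>f' a = 0\<close> show ?thesis by (simp add: max_absorb1)
  next
    case False
    have "(f has_real_derivative f' x) (at x)" by (rule f)
    then have "((\<lambda>x. f (max a x)) has_real_derivative f' x) (at x)"
      by (rule has_field_derivative_transform_within_open[of _ _ _ "{a<..}"])
        (use False in auto)
    with False show ?thesis
      by (simp add: max_absorb2 has_field_derivative_at_within)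
  qed
  show "((\<lambda>x. f (max a x)) has_real_derivative f' (max a x)) (at x within {x..})"
  \<comment> \<open>Strict here, non-strict for the left half-line: in this way \<open>x = a\<close>
    falls, on each side, into the case where a single formula holds on the whole half-line.\<close>
  proof (cases "x < a")
    case True
    have "((\<lambda>_. f a) has_real_derivative 0) (at x)" by simp
    then have "((\<lambda>x. f (max a x)) has_real_derivative 0) (at x)"
      by (rule has_field_derivative_transform_within_open[of _ _ _ "{..<a}"])
        (use True in auto)
    with True \<open>f' a = 0\<close> show ?thesis
      by (simp add: max_absorb1 has_field_derivative_at_within)
  next
    case False
    have "(f has_real_derivative f' x) (at x within {x..})"
      using f by (rule has_field_derivative_at_within)
    then have "((\<lambda>x. f (max a x)) has_real_derivative f' x) (at x within {x..})"
      by (rule has_field_derivative_transform_within[OF _ zero_less_one])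
        (use False in \<open>auto simp: max_absorb2\<close>)
    with False show ?thesis by (simp add: max_absorb2)
  qed
qed

text \<open>Follows from \<open>DERIV_comp_max\<close> by conjugating with the reflection at the
  origin, which turns stopping at \<open>b\<close> from above into stopping at \<open>- b\<close>
  from below.\<close>

lemma DERIV_comp_min:
  fixes f f' :: "real \<Rightarrow> real"
  assumes f: "\<And>x. (f has_real_derivative f' x) (at x)" and "f' b = 0"
  shows "((\<lambda>x. f (min b x)) has_real_derivative f' (min b x)) (at x)"
proof -
  have reflect: "((\<lambda>x. g (- x)) has_real_derivative - g' (- x)) (at x)"
    if "\<And>x. (g has_real_derivative g' x) (at x)" for g g' :: "real \<Rightarrow> real" and x
    using that[of "- x"] by (simp add: DERIV_mirror)
  have "((\<lambda>x. f (- max (- b) x)) has_real_derivative - f' (- max (- b) x)) (at x)" for x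
    using DERIV_comp_max[of "\<lambda>x. f (- x)" "\<lambda>x. - f' (- x)", OF reflect[of f f', OF f], of "- b"]
      \<open>f' b = 0\<close>
    by simp
  then have "((\<lambda>x. f (- max (- b) (- x))) has_real_derivative f' (- max (- b) (- x))) (at x)"
    using reflect[of "\<lambda>x. f (- max (- b) x)" "\<lambda>x. - f' (- max (- b) x)" x] by simp
  moreover have "- max (- b) (- y) = min b y" for y
    by (simp add: max_def min_def)
  ultimately show ?thesis by simp
qed

definition clamp01 :: "real \<Rightarrow> real" where
  "clamp01 x = max 0 (min 1 x)"

lemma DERIV_comp_clamp01:
  assumes "\<And>x. (f has_real_derivative f' x) (at x)" "f' 0 = 0" "f' 1 = 0"
  shows "((\<lambda>x. f (clamp01 x)) has_real_derivative f' (clamp01 x)) (at x)"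
  unfolding clamp01_def
  \<comment> \<open>The inner stop at 1 is removed first; its side condition is
    \<open>f' (max 0 1) = f' 1 = 0\<close>.\<close>
  by (rule DERIV_comp_min[of "\<lambda>x. f (max 0 x)" "\<lambda>x. f' (max 0 x)"])
    (use assms in \<open>auto intro: DERIV_comp_max\<close>)

text \<open>Only the values for \<open>i \<le> 3\<close> are derivatives of the septic polynomial.\<close>

definition septic_deriv :: "nat \<Rightarrow> real \<Rightarrow> real" where
  "septic_deriv i x =
     (if i = 0 then septic x
      else if i = 1 then 140 * x ^ 3 - 420 * x ^ 4 + 420 * x ^ 5 - 140 * x ^ 6
      else if i = 2 then 420 * x\<^sup>2 - 1680 * x ^ 3 + 2100 * x ^ 4 - 840 * x ^ 5
      else 840 * x - 5040 * x\<^sup>2 + 8400 * x ^ 3 - 4200 * x ^ 4)"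

text \<open>At 0 the value of the polynomial vanishes too, not only its derivatives. This makes the
  steps that have not yet begun contribute nothing.\<close>

lemma septic_deriv_0 [simp]: "septic_deriv i 0 = 0"
  by (simp add: septic_deriv_def septic_def)

lemma septic_deriv_Suc_1 [simp]: "septic_deriv (Suc i) 1 = 0"
  by (simp add: septic_deriv_def)

lemma DERIV_septic_deriv:
  assumes "i < 3"
  shows "(septic_deriv i has_real_derivative septic_deriv (Suc i) x) (at x)"
proof -
  have "(septic has_real_derivative 140 * x ^ 3 - 420 * x ^ 4 + 420 * x ^ 5 - 140 * x ^ 6) (at x)"
    unfolding septic_def [abs_def] by (rule derivative_eq_intros refl | simp)+
  moreover have "((\<lambda>x. 140 * x ^ 3 - 420 * x ^ 4 + 420 * x ^ 5 - 140 * x ^ 6) has_real_derivative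
      420 * x\<^sup>2 - 1680 * x ^ 3 + 2100 * x ^ 4 - 840 * x ^ 5) (at x)"
    by (rule derivative_eq_intros refl | simp)+
  moreover have "((\<lambda>x. 420 * x\<^sup>2 - 1680 * x ^ 3 + 2100 * x ^ 4 - 840 * x ^ 5) has_real_derivative
      840 * x - 5040 * x\<^sup>2 + 8400 * x ^ 3 - 4200 * x ^ 4) (at x)"
    by (rule derivative_eq_intros refl | simp)+
  moreover have "i = 0 \<or> i = 1 \<or> i = 2" using assms by linarith
  ultimately show ?thesis
    by (auto simp: septic_deriv_def [abs_def])
qed

lemma DERIV_septic_deriv_clamp01:
  assumes "i < 3"
  shows "((\<lambda>x. septic_deriv i (clamp01 x)) has_real_derivative
    septic_deriv (Suc i) (clamp01 x)) (at x)"
  by (rule DERIV_comp_clamp01) (use DERIV_septic_deriv[OF assms] in auto)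

definition step_sum :: "(nat \<Rightarrow> real) \<Rightarrow> nat \<Rightarrow> nat \<Rightarrow> real \<Rightarrow> real" where
  "step_sum c i N t = (\<Sum>j<N. c j * septic_deriv i (clamp01 (t - real j)))"

lemma DERIV_step_sum:
  assumes "i < 3"
  shows "(step_sum c i N has_real_derivative step_sum c (Suc i) N t) (at t)"
proof -
  have "((\<lambda>t. septic_deriv i (clamp01 (t - real j))) has_real_derivative
      septic_deriv (Suc i) (clamp01 (t - real j))) (at t)" for j
    using DERIV_shift[of "\<lambda>x. septic_deriv i (clamp01 x)" _ t "- real j"]
      DERIV_septic_deriv_clamp01[OF assms]
    by auto
  then show ?thesis
    unfolding step_sum_def [abs_def] by (intro DERIV_sum DERIV_cmult)
qed

lemma isCont_step_sum: "isCont (step_sum c i N) t"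
proof -
  have "isCont (septic_deriv i) x" for x
    unfolding septic_deriv_def [abs_def] septic_def
    by (cases "i = 0"; cases "i = 1"; cases "i = 2") simp_all
  moreover have "isCont (\<lambda>t. clamp01 (t - real j)) t" for j
    unfolding clamp01_def by (intro continuous_intros)
  ultimately have "isCont (\<lambda>t. septic_deriv i (clamp01 (t - real j))) t" for j
    by (rule isCont_o2[rotated])
  then show ?thesis
    unfolding step_sum_def [abs_def]
    by (intro continuous_sum continuous_mult continuous_const)
qed

text \<open>Terms with \<open>j > t\<close> vanish, so the number of terms, which jumps with
  \<open>t\<close>, may be replaced by any fixed \<open>N > t\<close>.\<close>

lemma step_sum_stable:
  assumes "t < real N"
  shows "step_sum c i (Suc (nat \<lfloor>t\<rfloor>)) t = step_sum c i N t"
proof -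
  have vanish: "c j * septic_deriv i (clamp01 (t - real j)) = 0" if "t < real j" for j
    using that by (simp add: clamp01_def)
  consider "N = 0" | "Suc (nat \<lfloor>t\<rfloor>) \<le> N"
    using assms by linarith
  then show ?thesis
  proof cases
    \<comment> \<open>Here \<open>t < 0\<close>, so \<open>nat\<close> truncates the floor to 0 and
      the single term \<open>j = 0\<close> remains; it vanishes.\<close>
    case 1
    with assms vanish[of 0] show ?thesis by (simp add: step_sum_def)
  next
    case 2
    have "t < real j" if "j \<notin> {..<Suc (nat \<lfloor>t\<rfloor>)}" for j
      using that by simp linarith
    with 2 show ?thesis
      unfolding step_sum_def by (intro sum.mono_neutral_left ballI vanish) auto
  qed
qed

text \<open>Smoothness is local: on the open set \<open>{..<real N}\<close> around \<open>t\<close>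
  the sum has a fixed number of terms and can be differentiated termwise.\<close>

lemma Ck_on_step_sum: "Ck_on 3 (\<lambda>t. step_sum c 0 (Suc (nat \<lfloor>t\<rfloor>)) t) UNIV"
  unfolding Ck_on_def
proof (intro exI[of _ "\<lambda>i t. step_sum c i (Suc (nat \<lfloor>t\<rfloor>)) t"] conjI allI impI ballI)
  fix i :: nat and t :: real
  assume "i < 3"
  obtain N where N: "t < real N" using reals_Archimedean2 by blast
  have "((\<lambda>t. step_sum c i (Suc (nat \<lfloor>t\<rfloor>)) t) has_real_derivative step_sum c (Suc i) N t) (at t)"
    by (rule has_field_derivative_transform_within_open[OF DERIV_step_sum[OF \<open>i < 3\<close>], of "{..<real N}"])
      (use N in \<open>auto simp: step_sum_stable\<close>)
  then show "((\<lambda>t. step_sum c i (Suc (nat \<lfloor>t\<rfloor>)) t) has_real_derivative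
      step_sum c (Suc i) (Suc (nat \<lfloor>t\<rfloor>)) t) (at t)"
    by (simp only: step_sum_stable[OF N])
next
  show "continuous_on UNIV (\<lambda>t. step_sum c 3 (Suc (nat \<lfloor>t\<rfloor>)) t)"
    unfolding continuous_on_eq_continuous_at[OF open_UNIV]
  proof
    fix t :: real
    obtain N where N: "t < real N" using reals_Archimedean2 by blast
    have "\<forall>\<^sub>F s in nhds t. s < real N"
      using eventually_nhds_in_open[of "{..<real N}" t] N by simp
    then have "\<forall>\<^sub>F s in nhds t. step_sum c 3 (Suc (nat \<lfloor>s\<rfloor>)) s = step_sum c 3 N s"
      by eventually_elim (rule step_sum_stable)
    then show "isCont (\<lambda>t. step_sum c 3 (Suc (nat \<lfloor>t\<rfloor>)) t) t"
      by (subst isCont_cong) (auto intro: isCont_step_sum)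
  qed
qed auto

text \<open>The steps \<open>j < k\<close> are completed and have the value
  \<open>septic 1 = 1\<close>; the step \<open>j = k\<close> is in progress and yields
  \<open>septic\<close> of the fractional part.\<close>

lemma li_eq_step_sum:
  assumes "\<tau> \<ge> 0"
  shows "li n \<tau> = step_sum (\<lambda>j. n / ln n * (fact j / ln n ^ j)) 0 (Suc (nat \<lfloor>\<tau>\<rfloor>)) \<tau>"
proof -
  define k where "k = nat \<lfloor>\<tau>\<rfloor>"
  have k: "of_int \<lfloor>\<tau>\<rfloor> = real k" "real k \<le> \<tau>" "\<tau> < real k + 1"
    using assms unfolding k_def by linarith+
  have "clamp01 (\<tau> - real j) = 1" if "j < k" for j
    using that k by (simp add: clamp01_def)
  moreover have "clamp01 (\<tau> - real k) = \<tau> - real k"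
    using k by (simp add: clamp01_def)
  moreover have "septic_deriv 0 x = septic x" "septic 1 = 1" for x
    by (simp_all add: septic_deriv_def septic_def)
  ultimately show ?thesis
    unfolding li_def Let_def step_sum_def k_def[symmetric] k(1)
    by (simp add: distrib_left sum_distrib_left mult_ac)
qed

theorem theorem2p2:
  fixes n :: real
  assumes "n > 1"
  shows "Ck_on 3 (\<lambda>\<tau>. li n \<tau>) {0..}"
proof -
  have "Ck_on 3 (\<lambda>\<tau>. step_sum (\<lambda>j. n / ln n * (fact j / ln n ^ j)) 0 (Suc (nat \<lfloor>\<tau>\<rfloor>)) \<tau>) {0..}"
    using Ck_on_step_sum by (rule Ck_on_subset) simp
  then show ?thesis
    \<comment> \<open>\<open>Ck_on\<close> sees the function only through its values on the set, so
      agreement for \<tau> \<ge> 0 suffices, even at the end point 0.\<close>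
    by (simp add: Ck_on_def li_eq_step_sum)
qed

end
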